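(* Treated as initial (starting) positions, the $P$-positions of Imitation Nim are identical to the $P$-positions of Wythoff Nim.
   Context: Positions are pairs $(a,b)$ of non-negative integers, the heights of two piles of tokens. Two players alternate; a player unable to move loses (normal play). A position is a $P$-position if the previous player (the one not about to move) wins given best play. **Imitation Nim.** A move removes a positive number of tokens from exactly one pile (2-pile Nim), except that a player may not imitate the previous player's move. Here, let $A$ and $B$ be the two piles with $\#A\le\#B$, the tokens being counted before the previous player's removal (if the heights are equal, either pile may play the role of $A$); if the previous player removed $x$ tokens from pile $A$, the next player imitates if he removes exactly $x$ tokens from pile $B$. No other move is an imitation; the first move of the game is never an imitation. **Wythoff Nim.** A move removes either a positive number of tokens from exactly one pile, or the same positive number of tokens from both piles. *)

theory Defs
  imports Main
begin

text \<open>
  An impartial game under normal play is given by its move relation on states. A state is a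
  \<open>P\<close>-position if the player who is not about to move can force a win, and an \<open>N\<close>-position if
  the player about to move can. A state without moves is a \<open>P\<close>-position.
\<close>

inductive P_position :: "('s \<Rightarrow> 's \<Rightarrow> bool) \<Rightarrow> 's \<Rightarrow> bool"
  and N_position :: "('s \<Rightarrow> 's \<Rightarrow> bool) \<Rightarrow> 's \<Rightarrow> bool"
  for move :: "'s \<Rightarrow> 's \<Rightarrow> bool"
where
  P_positionI: "(\<And>t. move s t \<Longrightarrow> N_position move t) \<Longrightarrow> P_position move s"
| N_positionI: "move s t \<Longrightarrow> P_position move t \<Longrightarrow> N_position move s"

type_synonym position = "nat \<times> nat"

datatype pile = First | Second

fun other :: "pile \<Rightarrow> pile" where
  "other First = Second"
| "other Second = First"

fun height :: "position \<Rightarrow> pile \<Rightarrow> nat" where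
  "height (a, b) First = a"
| "height (a, b) Second = b"

definition removes :: "pile \<Rightarrow> nat \<Rightarrow> position \<Rightarrow> position \<Rightarrow> bool" where
  "removes i x p q \<longleftrightarrow>
     x > 0 \<and> height p i = height q i + x \<and> height p (other i) = height q (other i)"

definition nim_move :: "position \<Rightarrow> position \<Rightarrow> bool" where
  "nim_move p q \<longleftrightarrow> (\<exists>i x. removes i x p q)"

definition wythoff_move :: "position \<Rightarrow> position \<Rightarrow> bool" where
  "wythoff_move p q \<longleftrightarrow>
     nim_move p q \<or> (\<exists>x>0. \<forall>i. height p i = height q i + x)"

text \<open>
  \<open>imitates p q r\<close>: the move from \<open>q\<close> to \<open>r\<close> imitates the move from \<open>p\<close> to \<open>q\<close> that the
  opponent has just made. The heights are compared in \<open>p\<close>, before the opponent's removal; if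
  they are equal there, either pile qualifies as \<open>A\<close>.
\<close>

definition imitates :: "position \<Rightarrow> position \<Rightarrow> position \<Rightarrow> bool" where
  "imitates p q r \<longleftrightarrow>
     (\<exists>A x. height p A \<le> height p (other A) \<and> removes A x p q \<and> removes (other A) x q r)"

text \<open>
  The options of a position depend on the previous move, so a state of Imitation Nim is a current
  position together with the position before the previous move (\<open>None\<close> if there was no such move).
\<close>

inductive imitation_nim_move ::
  "position option \<times> position \<Rightarrow> position option \<times> position \<Rightarrow> bool"
where
  initial_move: "nim_move q r \<Longrightarrow> imitation_nim_move (None, q) (Some q, r)"
| later_move: "nim_move q r \<Longrightarrow> \<not> imitates p q r \<Longrightarrow> imitation_nim_move (Some p, q) (Some q, r)"

end

theory Submission
  imports Defs
begin

text \<open>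
  Removing \<open>x\<close> tokens from the lower pile \<open>A\<close> of \<open>p\<close>, and then \<open>x\<close> tokens from the other pile,
  amounts to a diagonal move of Wythoff Nim; this is exactly what a player may not complete after
  the opponent has begun it. So a player of Imitation Nim who wants to make the diagonal move from
  \<open>p\<close> to \<open>r\<close> removes only the \<open>x\<close> tokens from the lower pile and leaves the opponent in front of
  the good position \<open>r\<close>, which is now forbidden. Let \<open>W\<close> be the set of \<open>P\<close>-positions of Wythoff
  Nim. The claim is that the states from which the player about to move loses Imitation Nim are
  those whose position is in \<open>W\<close> and those in which the one forbidden move would lead into \<open>W\<close>
  (\<open>lost_state\<close>). A starting position has no forbidden move, so the theorem follows.

  The losing states of a terminating game are its only kernel (\<open>P_position_iff_kernel\<close>), so it
  remains to see that no move joins two lost states and that each other state has a move to a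
  lost one. The only difficult point is a state in which the move into \<open>W\<close> is forbidden: it
  must offer neither another move into \<open>W\<close> nor a new start of a diagonal move into \<open>W\<close>. Each of
  these would give two elements of \<open>W\<close> such that the one with the lower pile \<open>A\<close> has the larger
  height difference. But in \<open>W\<close> a lower pile \<open>A\<close> means a smaller difference
  (\<open>wythoff_P_difference_mono\<close>). This holds because the differences of elements of \<open>W\<close> are
  distinct and, as pile \<open>A\<close> grows, appear without gaps: below an element of difference \<open>d\<close> there
  is one of each difference \<open>m < d\<close> (\<open>wythoff_P_smaller_difference\<close>).
\<close>

section \<open>Kernels of terminating games\<close>

lemma P_position_not_N_position:
  shows "P_position move s \<Longrightarrow> \<not> N_position move s"
    and "N_position move s \<Longrightarrow> \<not> P_position move s"
proof (induction rule: P_position_N_position.inducts)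
  case (P_positionI s)
  then show ?case by (auto elim: N_position.cases)
next
  case (N_positionI s t)
  then show ?case by (auto elim: P_position.cases)
qed

lemma P_position_iff_kernel:
  assumes wf: "wf {(t, s). move s t}"
    and independent: "\<And>s t. s \<in> K \<Longrightarrow> move s t \<Longrightarrow> t \<notin> K"
    and absorbing: "\<And>s. s \<notin> K \<Longrightarrow> \<exists>t\<in>K. move s t"
  shows "P_position move s \<longleftrightarrow> s \<in> K"
proof -
  have "(s \<in> K \<longrightarrow> P_position move s) \<and> (s \<notin> K \<longrightarrow> N_position move s)"
    using wf
  proof (induction s rule: wf_induct_rule)
    case (less s)
    show ?case
    proof (intro conjI impI)
      assume "s \<in> K"
      then show "P_position move s"
        using less independent by (intro P_positionI) blast
    next
      assume "s \<notin> K"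
      then obtain t where "t \<in> K" "move s t"
        using absorbing by blast
      then show "N_position move s"
        using less by (intro N_positionI) blast+
    qed
  qed
  then show ?thesis
    using P_position_not_N_position by metis
qed

lemma N_position_if_not_P_position:
  assumes "wf {(t, s). move s t}" and "\<not> P_position move s"
  shows "N_position move s"
  using assms
proof (induction s rule: wf_induct_rule)
  case (less s)
  then obtain t where "move s t" "\<not> N_position move t"
    by (auto intro: P_positionI)
  with less have "P_position move t" by blast
  with \<open>move s t\<close> show ?case by (rule N_positionI)
qed

section \<open>Heights and moves\<close>

lemma other_other [simp]: "other (other A) = A"
  by (cases A) auto

lemma pile_eq_or_other: "i = A \<or> i = other A"
  by (cases i; cases A) auto

lemma all_piles_iff: "(\<forall>i. Q i) \<longleftrightarrow> Q A \<and> Q (other A)"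
  using pile_eq_or_other[of _ A] by metis

lemma position_with_heights:
  obtains p where "height p A = m" "height p (other A) = n"
proof (cases A)
  case First
  then show thesis using that[of "(m, n)"] by simp
next
  case Second
  then show thesis using that[of "(n, m)"] by simp
qed

lemma position_eqI:
  "height p A = height q A \<Longrightarrow> height p (other A) = height q (other A) \<Longrightarrow> p = q"
  by (cases p; cases q; cases A) auto

lemma removes_nim_move: "removes A x p q \<Longrightarrow> nim_move p q"
  unfolding nim_move_def by blast

lemma nim_move_iff:
  "nim_move p q \<longleftrightarrow>
     height q A < height p A \<and> height q (other A) = height p (other A) \<or>
     height q A = height p A \<and> height q (other A) < height p (other A)"
    (is "_ \<longleftrightarrow> ?R")
proof
  assume "nim_move p q"
  then obtain i x where "removes i x p q"
    unfolding nim_move_def by blast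
  then show ?R
    using pile_eq_or_other[of i A] by (auto simp: removes_def)
next
  assume ?R
  then have "removes A (height p A - height q A) p q \<or>
      removes (other A) (height p (other A) - height q (other A)) p q"
    by (auto simp: removes_def)
  then show "nim_move p q"
    using removes_nim_move by blast
qed

lemma wythoff_move_iff:
  "wythoff_move p q \<longleftrightarrow>
     nim_move p q \<or>
     (\<exists>x>0. height p A = height q A + x \<and> height p (other A) = height q (other A) + x)"
  unfolding wythoff_move_def all_piles_iff[of _ A] ..

lemma nim_move_imp_wythoff_move: "nim_move p q \<Longrightarrow> wythoff_move p q"
  by (simp add: wythoff_move_def)

lemma wythoff_move_diagonalI:
  assumes "height q A < height p A"
    and "height p A + height q (other A) = height q A + height p (other A)"
  shows "wythoff_move p q"
  unfolding wythoff_move_iff[of p q A]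
  using assms by (intro disjI2 exI[of _ "height p A - height q A"]) auto

lemma wythoff_move_decreases:
  "wythoff_move p q \<Longrightarrow>
    height q First + height q Second < height p First + height p Second"
  using wythoff_move_iff[of p q First] nim_move_iff[of p q First] by auto

lemma wf_wythoff_move: "wf {(q, p). wythoff_move p q}"
  by (rule wf_subset[OF wf_measure[of "\<lambda>p. height p First + height p Second"]])
    (auto simp del: height.simps dest: wythoff_move_decreases)

lemma wf_imitation_nim_move: "wf {(t, s). imitation_nim_move s t}"
  by (rule wf_subset[OF wf_measure[of "\<lambda>s. height (snd s) First + height (snd s) Second"]])
    (auto simp del: height.simps elim!: imitation_nim_move.cases
      dest!: nim_move_imp_wythoff_move wythoff_move_decreases)

lemma imitates_imp_wythoff_move:
  assumes "imitates p q r"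
  shows "wythoff_move p r"
proof -
  obtain A x where "removes A x p q" "removes (other A) x q r"
    using assms unfolding imitates_def by blast
  then show ?thesis
    by (intro wythoff_move_diagonalI[of r A]) (auto simp: removes_def)
qed

section \<open>Height differences of the P-positions of Wythoff Nim\<close>

lemma wythoff_P_no_move:
  "P_position wythoff_move p \<Longrightarrow> P_position wythoff_move q \<Longrightarrow> \<not> wythoff_move p q"
  using N_positionI P_position_not_N_position by metis

lemma wythoff_P_no_nim_move:
  "P_position wythoff_move p \<Longrightarrow> P_position wythoff_move q \<Longrightarrow> \<not> nim_move p q"
  using wythoff_P_no_move nim_move_imp_wythoff_move by blast

lemma wythoff_P_reachable:
  assumes "\<not> P_position wythoff_move p"
  obtains q where "wythoff_move p q" "P_position wythoff_move q"
  using N_position_if_not_P_position[OF wf_wythoff_move assms] by (auto elim: N_position.cases)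

text \<open>
  Lowering the higher pile of \<open>p\<close> until the difference is \<open>m\<close> gives a position from which the
  player about to move wins. The winning move lowers pile \<open>A\<close>, as its target would otherwise be
  an option of \<open>p\<close>. If it is diagonal, it keeps the difference \<open>m\<close>; if not, it reaches a
  \<open>P\<close>-position with a lower pile \<open>A\<close> and a difference above \<open>m\<close>, and the induction goes on.
\<close>

lemma wythoff_P_smaller_difference:
  assumes "P_position wythoff_move p" and "height p A + m < height p (other A)"
  shows "\<exists>q. P_position wythoff_move q \<and> height q A < height p A \<and>
    height q (other A) = height q A + m"
  using assms
proof (induction "height p A" arbitrary: p rule: less_induct)
  case less
  obtain s where s: "height s A = height p A" "height s (other A) = height p A + m"
    by (rule position_with_heights)
  then have "nim_move p s"
    using less.prems by (simp add: nim_move_iff[of p s A])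
  then have "\<not> P_position wythoff_move s"
    using less.prems wythoff_P_no_nim_move by blast
  then obtain t where t: "wythoff_move s t" "P_position wythoff_move t"
    by (rule wythoff_P_reachable)
  have "\<not> nim_move p t"
    using less.prems t wythoff_P_no_nim_move by blast
  then have "height t A < height p A \<and> height t (other A) = height p A + m \<or>
      height t A < height p A \<and> height t (other A) = height t A + m"
    using t s less.prems
    by (auto simp: wythoff_move_iff[of s t A] nim_move_iff[of s t A] nim_move_iff[of p t A])
  then show ?case
  proof
    assume "height t A < height p A \<and> height t (other A) = height p A + m"
    then show ?thesis
      using less.hyps[of t] t by fastforce
  next
    assume "height t A < height p A \<and> height t (other A) = height t A + m"
    then show ?thesis using t by blast
  qed
qed

text \<open>
  If the differences were in the other order, \<open>p\<close> or some \<open>P\<close>-position with a still lower pile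
  \<open>A\<close> would have the difference of \<open>q\<close>, and a diagonal move would lead from \<open>q\<close> to it.
\<close>

lemma wythoff_P_difference_mono:
  assumes p: "P_position wythoff_move p" and q: "P_position wythoff_move q"
    and lower: "height p A < height q A"
    and ordered: "height q A \<le> height q (other A)"
  shows "height p (other A) + height q A < height q (other A) + height p A"
proof (rule ccontr)
  assume "\<not> ?thesis"
  then consider
      "height p (other A) + height q A = height q (other A) + height p A"
    | "height p A + (height q (other A) - height q A) < height p (other A)"
    using ordered by linarith
  then show False
  proof cases
    case 1
    then have "wythoff_move q p"
      using lower by (intro wythoff_move_diagonalI[of p A]) auto
    then show False using p q wythoff_P_no_move by blast
  next
    case 2
    then obtain u where u: "P_position wythoff_move u" "height u A < height p A"
        "height u (other A) = height u A + (height q (other A) - height q A)"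
      using wythoff_P_smaller_difference[OF p] by blast
    then have "wythoff_move q u"
      using lower ordered by (intro wythoff_move_diagonalI[of u A]) auto
    then show False using u q wythoff_P_no_move by blast
  qed
qed

section \<open>The lost states of Imitation Nim\<close>

definition forbidden_win :: "position \<Rightarrow> position \<Rightarrow> bool" where
  "forbidden_win p q \<longleftrightarrow> (\<exists>r. imitates p q r \<and> P_position wythoff_move r)"

fun lost_state :: "position option \<times> position \<Rightarrow> bool" where
  "lost_state (None, q) \<longleftrightarrow> P_position wythoff_move q"
| "lost_state (Some p, q) \<longleftrightarrow> P_position wythoff_move q \<or> forbidden_win p q"

lemma wythoff_P_not_forbidden_win:
  "P_position wythoff_move q \<Longrightarrow> \<not> forbidden_win q r"
  unfolding forbidden_win_def using imitates_imp_wythoff_move wythoff_P_no_move by blast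

text \<open>
  After the first half of a diagonal move, let \<open>A\<close> be the pile that was lowered and \<open>s\<close> the
  forbidden target. A second winning idea, either an element of \<open>W\<close> or the beginning of
  another diagonal move, would lower \<open>A\<close> still further, although the difference between the piles
  is already larger than in \<open>s\<close>.
\<close>

lemma forbidden_win_no_other_win:
  assumes win: "forbidden_win p q" and move: "nim_move q r" "\<not> imitates p q r"
  shows "\<not> P_position wythoff_move r" and "\<not> forbidden_win q r"
proof -
  obtain s A x where s: "P_position wythoff_move s" "height p A \<le> height p (other A)"
      "removes A x p q" "removes (other A) x q s"
    using win unfolding forbidden_win_def imitates_def by blast
  have heights: "0 < x" "height s A = height q A" "height q (other A) = height s (other A) + x"
      "height s A \<le> height s (other A)"
    using s by (auto simp: removes_def)
  have "r \<noteq> s"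
    using move s unfolding imitates_def by blast
  show "\<not> P_position wythoff_move r"
  proof
    assume r: "P_position wythoff_move r"
    have "\<not> nim_move r s" "\<not> nim_move s r"
      using r s wythoff_P_no_nim_move by blast+
    then have "height r A < height q A" "height r (other A) = height q (other A)"
      using \<open>r \<noteq> s\<close> move heights position_eqI[of r A s]
      by (auto simp: nim_move_iff[of _ _ A])
    then show False
      using wythoff_P_difference_mono[OF r s(1), of A] heights by simp
  qed
  show "\<not> forbidden_win q r"
  proof
    assume "forbidden_win q r"
    then obtain u B y where u: "P_position wythoff_move u" "height q B \<le> height q (other B)"
        "removes B y q r" "removes (other B) y r u"
      unfolding forbidden_win_def imitates_def by blast
    have "B = A"
      using u heights pile_eq_or_other[of B A] by auto
    with u have "0 < y" "height q A = height u A + y"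
        "height q (other A) = height u (other A) + y"
      by (auto simp: removes_def)
    then show False
      using wythoff_P_difference_mono[OF u(1) s(1), of A] heights by simp
  qed
qed

lemma lost_state_no_move_to_lost_state:
  assumes "imitation_nim_move s t" and "lost_state s"
  shows "\<not> lost_state t"
  using assms
proof cases
  case (initial_move q r)
  then show ?thesis
    using assms(2) wythoff_P_no_nim_move[of q r] wythoff_P_not_forbidden_win[of q r] by auto
next
  case (later_move q r p)
  then show ?thesis
    using assms(2) wythoff_P_no_nim_move[of q r] wythoff_P_not_forbidden_win[of q r]
      forbidden_win_no_other_win[of p q r] by auto
qed

text \<open>
  A diagonal move into \<open>W\<close> is begun on the lower pile \<open>A\<close>. Such a beginning never imitates: that
  would require the previous move to have lowered the other pile when it was not the higher one,
  and then that pile would now be lower than \<open>A\<close>.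
\<close>

lemma winning_nim_move:
  assumes "\<not> P_position wythoff_move q"
  obtains r where "nim_move q r" "P_position wythoff_move r"
  | r where "nim_move q r" "forbidden_win q r" "\<And>p. \<not> imitates p q r"
proof -
  obtain s where s: "wythoff_move q s" "P_position wythoff_move s"
    using assms by (rule wythoff_P_reachable)
  show thesis
  proof (cases "nim_move q s")
    case True
    then show thesis using s that by blast
  next
    case False
    obtain A where A: "height q A \<le> height q (other A)"
    proof (cases "height q First \<le> height q Second")
      case True
      then show thesis using that[of First] by simp
    next
      case False
      then show thesis using that[of Second] by simp
    qed
    obtain x where x: "0 < x" "height q A = height s A + x"
        "height q (other A) = height s (other A) + x"
      using s False by (auto simp: wythoff_move_iff[of q s A])
    obtain r where r: "height r A = height s A" "height r (other A) = height q (other A)"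
      by (rule position_with_heights)
    have first_half: "removes A x q r" and second_half: "removes (other A) x r s"
      using r x by (auto simp: removes_def)
    then have "forbidden_win q r"
      using A s unfolding forbidden_win_def imitates_def by blast
    moreover have "\<not> imitates p q r" for p
    proof
      assume "imitates p q r"
      then obtain B y where B: "height p B \<le> height p (other B)" "removes B y p q"
          "removes (other B) y q r"
        unfolding imitates_def by blast
      then have "B = other A"
        using first_half pile_eq_or_other[of B A] by (auto simp: removes_def)
      then show False
        using B A by (auto simp: removes_def)
    qed
    ultimately show thesis
      using that(2) removes_nim_move[OF first_half] by blast
  qed
qed

lemma move_to_lost_state:
  assumes "\<not> lost_state s"
  shows "\<exists>t. lost_state t \<and> imitation_nim_move s t"
proof -
  obtain prev q where sq: "s = (prev, q)"
    by (cases s)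
  then have "\<not> P_position wythoff_move q"
    using assms by (cases prev) auto
  then obtain r where "nim_move q r" "lost_state (Some q, r)"
      "\<forall>p. prev = Some p \<longrightarrow> \<not> imitates p q r"
  proof (cases q rule: winning_nim_move)
    case (1 r)
    have "\<not> imitates p q r" if "prev = Some p" for p
    proof -
      have "\<not> forbidden_win p q"
        using assms sq that by simp
      then show ?thesis
        using 1(2) unfolding forbidden_win_def by blast
    qed
    with 1 show thesis using that by auto
  next
    case (2 r)
    then show thesis using that by auto
  qed
  then have "lost_state (Some q, r) \<and> imitation_nim_move s (Some q, r)"
    by (cases prev) (auto simp: sq intro: imitation_nim_move.intros)
  then show ?thesis ..
qed

theorem corollary0:
  "{p :: nat \<times> nat. P_position imitation_nim_move (None, p)} = {p. P_position wythoff_move p}"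
proof -
  have "P_position imitation_nim_move s \<longleftrightarrow> s \<in> Collect lost_state" for s
    using wf_imitation_nim_move
  proof (rule P_position_iff_kernel)
    show "t \<notin> Collect lost_state"
      if "s \<in> Collect lost_state" "imitation_nim_move s t" for s t
      using that lost_state_no_move_to_lost_state by blast
    show "\<exists>t\<in>Collect lost_state. imitation_nim_move s t"
      if "s \<notin> Collect lost_state" for s
      using that move_to_lost_state by blast
  qed
  then show ?thesis by simp
qed

end
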